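(* Let $\Omega_k\subsetneq\Omega$ be a strict subset of the sample space $\Omega$, let $x\in\Omega\setminus\Omega_k$ be an arbitrary sample not in $\Omega_k$, and let $\Omega_j=\Omega_k\cup\{x\}$. For a fixed $\alpha$, let $\mathcal{F}_{\min}$ be the set of minimizers of $\mu(F)$ over $F\in\mathrm{cl}\{F\in\mathcal{F}:\Pr_F(\Omega_k)>\alpha\}$, and suppose that $\mathcal{F}_{\min}$ is non-empty. Suppose further that there exists $F^*\in\mathcal{F}_{\min}$ that is an element of the open simplex $\mathcal{G}\subset\mathcal{F}$. Then $$B_j^*<B_k^*<\infty,$$ where $B_k^*$ and $B_j^*$ are the Buehler bounds for $\Omega_k$ and $\Omega_j$, respectively.
   Context: Fix a finite nonempty set $S\subset\mathbb{R}$, an integer $n\ge 1$ and $\alpha\in(0,1)$. The sample space is $\Omega=\Omega(S,n)=\{(x_1,\dots,x_n)\in S^n: x_1\le\dots\le x_n\}$. $\mathcal{F}=\mathcal{F}(S)$ (the closed simplex) is the set of all probability distributions on $S$, zero masses allowed, with the Euclidean topology on mass vectors; $\mathcal{G}=\mathcal{G}(S)$ (the open simplex) is the subset of distributions assigning strictly positive probability to every element of $S$. $\mu(F)=\sum_{s\in S}sF(s)$ is the mean. For $x\in\Omega$ containing $\hat x_s$ copies of $s$, $\Pr_F(x)=\frac{n!}{\prod_{s}\hat x_s!}\prod_{s\in S}F(s)^{\hat x_s}$ (with $0^0=1$), and $\Pr_F(A)=\sum_{x\in A}\Pr_F(x)$ for $A\subseteq\Omega$. $\mathrm{cl}$ denotes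 closure in $\mathcal{F}$. For a subset $\Phi\subseteq\Omega$, let $\mathcal{F}_\Phi=\mathrm{cl}\{F\in\mathcal{F}:\Pr_F(\Phi)>\alpha\}$. The Buehler bound for $\Phi$ is $\min_{F\in\mathcal{F}_\Phi}\mu(F)$ if $\mathcal{F}_\Phi\ne\emptyset$, and $\infty$ if $\mathcal{F}_\Phi=\emptyset$. *)

theory Defs
  imports "HOL-Analysis.Analysis"
begin

definition sample_space :: "real set \<Rightarrow> nat \<Rightarrow> real list set" where
  "sample_space S n = {x. length x = n \<and> set x \<subseteq> S \<and> sorted x}"

text \<open>
  A distribution on \<open>S\<close> is given by its mass function, extended by \<open>0\<close> outside \<open>S\<close>, so that
  distinct elements of \<open>prob_simplex S\<close> are distinct distributions. The library topology on
  \<open>real \<Rightarrow> real\<close> is the product topology; for finite \<open>S\<close> the topology it induces on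
  \<open>prob_simplex S\<close> is the Euclidean topology on mass vectors indexed by \<open>S\<close>, since all the
  other coordinates are constantly \<open>0\<close>.
\<close>

definition prob_simplex :: "real set \<Rightarrow> (real \<Rightarrow> real) set" where
  "prob_simplex S = {F. (\<forall>s\<in>S. 0 \<le> F s) \<and> (\<forall>s. s \<notin> S \<longrightarrow> F s = 0) \<and> (\<Sum>s\<in>S. F s) = 1}"

definition open_prob_simplex :: "real set \<Rightarrow> (real \<Rightarrow> real) set" where
  "open_prob_simplex S = {F \<in> prob_simplex S. \<forall>s\<in>S. 0 < F s}"

definition mean :: "real set \<Rightarrow> (real \<Rightarrow> real) \<Rightarrow> real" where
  "mean S F = (\<Sum>s\<in>S. s * F s)"

definition sample_prob :: "real set \<Rightarrow> nat \<Rightarrow> (real \<Rightarrow> real) \<Rightarrow> real list \<Rightarrow> real" where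
  "sample_prob S n F x =
     fact n / (\<Prod>s\<in>S. fact (count_list x s)) * (\<Prod>s\<in>S. F s ^ count_list x s)"

definition event_prob :: "real set \<Rightarrow> nat \<Rightarrow> (real \<Rightarrow> real) \<Rightarrow> real list set \<Rightarrow> real" where
  "event_prob S n F A = (\<Sum>x\<in>A. sample_prob S n F x)"

definition feasible_set :: "real set \<Rightarrow> nat \<Rightarrow> real \<Rightarrow> real list set \<Rightarrow> (real \<Rightarrow> real) set" where
  "feasible_set S n \<alpha> \<Phi> =
     top_of_set (prob_simplex S) closure_of {F \<in> prob_simplex S. event_prob S n F \<Phi> > \<alpha>}"

definition mean_minimizers :: "real set \<Rightarrow> nat \<Rightarrow> real \<Rightarrow> real list set \<Rightarrow> (real \<Rightarrow> real) set" where
  "mean_minimizers S n \<alpha> \<Phi> = {F. is_arg_min (mean S) (\<lambda>F. F \<in> feasible_set S n \<alpha> \<Phi>) F}"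

text \<open>
  The least element below exists whenever \<open>S\<close> is finite and the feasible set is nonempty: the
  feasible set is then compact and \<open>mean S\<close> is continuous.
\<close>

definition buehler_bound :: "real set \<Rightarrow> nat \<Rightarrow> real \<Rightarrow> real list set \<Rightarrow> ereal" where
  "buehler_bound S n \<alpha> \<Phi> =
     (if feasible_set S n \<alpha> \<Phi> = {} then \<infinity>
      else ereal (LEAST m. m \<in> mean S ` feasible_set S n \<alpha> \<Phi>))"

end

theory Submission
  imports Defs
begin

text \<open>
  Let \<open>F\<close> be a full-support minimizer of the mean for \<open>\<Omega>\<^sub>k\<close>. Since \<open>F\<close> is a limit of distributions
  giving \<open>\<Omega>\<^sub>k\<close> probability greater than \<open>\<alpha>\<close>, continuity yields the weak inequality
  \<open>event_prob S n F \<Omega>\<^sub>k \<ge> \<alpha>\<close> (lemma \<open>feasible_event_prob_ge\<close>). Adding the sample \<open>x\<close>, which has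
  positive probability under a full-support \<open>F\<close>, makes it strict: \<open>event_prob S n F \<Omega>\<^sub>j > \<alpha>\<close>.
  A strict inequality survives a small perturbation, so a little mass can be moved from a larger
  to a smaller element of \<open>S\<close>: there is mass to move because \<open>F\<close> has full support, and the
  resulting distribution is still feasible for \<open>\<Omega>\<^sub>j\<close> and has a strictly smaller mean (lemma
  \<open>event_prob_slack_mean_less\<close>). Two distinct elements of \<open>S\<close> exist, since \<open>\<Omega>\<^sub>k\<close> has positive
  probability and hence contains a sample, which differs from \<open>x\<close>.

  Compactness of the simplex guarantees that the bound for \<open>\<Omega>\<^sub>j\<close> is an attained minimum, and thus
  at most the mean of that perturbed distribution.
\<close>

lemma continuous_on_coordinate: "continuous_on A (\<lambda>F :: 'a \<Rightarrow> real. F s)"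
  by (rule continuous_on_subset[OF continuous_on_product_coordinates]) simp

lemma continuous_on_mean: "continuous_on A (mean S)"
  unfolding mean_def[abs_def]
  by (intro continuous_on_sum continuous_on_mult continuous_on_const continuous_on_coordinate)

lemma continuous_on_event_prob: "continuous_on A (\<lambda>F. event_prob S n F \<Phi>)"
  unfolding event_prob_def sample_prob_def
  by (intro continuous_on_sum continuous_on_mult continuous_on_const continuous_on_prod
      continuous_on_power continuous_on_coordinate)

text \<open>
  The simplex is the intersection of a product of compact intervals, compact by Tychonoff, with the
  closed hyperplane of functions of total mass one.
\<close>

lemma compact_prob_simplex:
  assumes "finite S"
  shows "compact (prob_simplex S)"
proof -
  let ?B = "\<lambda>s. if s \<in> S then {0..1::real} else {0}"
  let ?H = "{F::real \<Rightarrow> real. (\<Sum>s\<in>S. F s) = 1}"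
  have "compactin (product_topology (\<lambda>_::real. euclidean) UNIV) (Pi\<^sub>E UNIV ?B)"
    by (subst compactin_PiE) auto
  hence "compact (Pi\<^sub>E UNIV ?B)"
    by (simp add: euclidean_product_topology)
  moreover have "closed ?H"
    by (intro closed_Collect_eq continuous_on_sum continuous_on_const continuous_on_coordinate)
  moreover have "prob_simplex S = Pi\<^sub>E UNIV ?B \<inter> ?H"
  proof -
    have "F s \<le> 1" if "F \<in> prob_simplex S" "s \<in> S" for F s
      using that member_le_sum[of s S F] assms by (auto simp: prob_simplex_def)
    then show ?thesis
      by (auto simp: prob_simplex_def PiE_iff split: if_splits)
  qed
  ultimately show ?thesis
    by (simp add: compact_Int_closed)
qed

lemma feasible_set_eq:
  "feasible_set S n \<alpha> \<Phi> =
     prob_simplex S \<inter> closure {F \<in> prob_simplex S. event_prob S n F \<Phi> > \<alpha>}"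
  unfolding feasible_set_def closure_of_subtopology
  by (simp add: Int_absorb1 Collect_restrict)

lemma compact_feasible_set:
  assumes "finite S"
  shows "compact (feasible_set S n \<alpha> \<Phi>)"
  unfolding feasible_set_eq by (intro compact_Int_closed compact_prob_simplex assms closed_closure)

lemma feasible_setI:
  assumes "F \<in> prob_simplex S" "event_prob S n F \<Phi> > \<alpha>"
  shows "F \<in> feasible_set S n \<alpha> \<Phi>"
  unfolding feasible_set_eq using assms by (intro IntI subsetD[OF closure_subset]) auto

lemma feasible_event_prob_ge:
  assumes "F \<in> feasible_set S n \<alpha> \<Phi>"
  shows "event_prob S n F \<Phi> \<ge> \<alpha>"
proof -
  have "closed {F. \<alpha> \<le> event_prob S n F \<Phi>}"
    by (intro closed_Collect_le continuous_on_event_prob continuous_on_const)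
  hence "closure {F \<in> prob_simplex S. event_prob S n F \<Phi> > \<alpha>} \<subseteq> {F. \<alpha> \<le> event_prob S n F \<Phi>}"
    by (intro closure_minimal) auto
  with assms show ?thesis
    unfolding feasible_set_eq by auto
qed

lemma buehler_bound_minimizer:
  assumes "F \<in> mean_minimizers S n \<alpha> \<Phi>"
  shows "buehler_bound S n \<alpha> \<Phi> = ereal (mean S F)"
proof -
  have F: "F \<in> feasible_set S n \<alpha> \<Phi>"
    and min: "\<And>G. G \<in> feasible_set S n \<alpha> \<Phi> \<Longrightarrow> mean S F \<le> mean S G"
    using assms by (auto simp: mean_minimizers_def is_arg_min_linorder)
  have "(LEAST m. m \<in> mean S ` feasible_set S n \<alpha> \<Phi>) = mean S F"
    by (rule Least_equality) (use F min in auto)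
  with F show ?thesis
    by (auto simp: buehler_bound_def)
qed

lemma buehler_bound_le_mean:
  assumes "finite S" "F \<in> feasible_set S n \<alpha> \<Phi>"
  shows "buehler_bound S n \<alpha> \<Phi> \<le> ereal (mean S F)"
proof -
  obtain G where G: "G \<in> feasible_set S n \<alpha> \<Phi>"
      "\<And>H. H \<in> feasible_set S n \<alpha> \<Phi> \<Longrightarrow> mean S G \<le> mean S H"
    using continuous_attains_inf[OF compact_feasible_set[OF assms(1)] _ continuous_on_mean] assms(2)
    by blast
  hence "G \<in> mean_minimizers S n \<alpha> \<Phi>"
    by (auto simp: mean_minimizers_def is_arg_min_linorder)
  from buehler_bound_minimizer[OF this] G(2)[OF assms(2)] show ?thesis
    by simp
qed

lemma finite_sample_space:
  assumes "finite S"
  shows "finite (sample_space S n)"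
  by (rule finite_subset[OF _ finite_lists_length_eq[OF assms, of n]])
    (auto simp: sample_space_def)

lemma sample_prob_pos:
  assumes "F \<in> open_prob_simplex S"
  shows "sample_prob S n F x > 0"
  using assms unfolding sample_prob_def open_prob_simplex_def
  by (intro mult_pos_pos divide_pos_pos prod_pos) auto

text \<open>
  Full support leaves mass at the larger point to move to the smaller one, and by continuity a
  small enough amount keeps the event probability above the threshold.
\<close>

lemma event_prob_slack_mean_less:
  assumes "finite S" and F: "F \<in> open_prob_simplex S" and gt: "event_prob S n F \<Phi> > \<alpha>"
    and ab: "a \<in> S" "b \<in> S" "a < b"
  obtains G where "G \<in> prob_simplex S" "event_prob S n G \<Phi> > \<alpha>" "mean S G < mean S F"
proof -
  define shift where "shift t = (\<lambda>s. F s + t * (indicator {a} s - indicator {b} s))" for t :: real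
  have "continuous_on UNIV shift"
    unfolding shift_def
    by (intro continuous_on_coordinatewise_then_product continuous_on_add continuous_on_mult
        continuous_on_const continuous_on_id)
  hence "continuous_on UNIV (\<lambda>t. event_prob S n (shift t) \<Phi>)"
    by (rule continuous_on_compose2[OF continuous_on_event_prob[of UNIV]]) auto
  hence "((\<lambda>t. event_prob S n (shift t) \<Phi>) \<longlongrightarrow> event_prob S n (shift 0) \<Phi>) (at_right 0)"
    by (auto simp: continuous_on_def intro: tendsto_within_subset)
  moreover have "shift 0 = F"
    by (simp add: shift_def)
  ultimately have "\<forall>\<^sub>F t in at_right 0. event_prob S n (shift t) \<Phi> > \<alpha>"
    using gt by (auto intro: order_tendstoD(1))
  moreover have Fb: "F b > 0"
    using F ab by (auto simp: open_prob_simplex_def)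
  hence "\<forall>\<^sub>F t in at_right 0. t \<in> {0<..<F b}"
    by (rule eventually_at_right_real)
  ultimately have "\<forall>\<^sub>F t in at_right 0. event_prob S n (shift t) \<Phi> > \<alpha> \<and> t \<in> {0<..<F b}"
    by (rule eventually_conj)
  then obtain t where t: "event_prob S n (shift t) \<Phi> > \<alpha>" "0 < t" "t < F b"
    using eventually_happens'[OF trivial_limit_at_right_real] by fastforce
  have "(\<Sum>s\<in>S. shift t s) = (\<Sum>s\<in>S. F s)"
    using assms(1) ab
    by (simp add: shift_def sum.distrib sum_subtractf indicator_def flip: sum_distrib_left)
  hence "shift t \<in> prob_simplex S"
    using F ab t by (auto simp: prob_simplex_def open_prob_simplex_def shift_def indicator_def)
  moreover have "mean S (shift t) = mean S F + t * (a - b)"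
  proof -
    have "mean S (shift t) = mean S F + t * (\<Sum>s\<in>S. s * indicator {a} s - s * indicator {b} s)"
      by (simp add: mean_def shift_def algebra_simps sum_distrib_left flip: sum.distrib)
    then show ?thesis
      using assms(1) ab by (simp add: sum_subtractf indicator_def)
  qed
  hence "mean S (shift t) < mean S F"
    using t ab by (simp add: mult_pos_neg)
  ultimately show thesis
    using that t(1) by blast
qed

text \<open>Two distinct samples therefore require two distinct elements of \<open>S\<close>.\<close>

lemma sample_space_singleton: "sample_space {a} n \<subseteq> {replicate n a}"
  by (auto simp: sample_space_def intro!: replicate_eqI)

theorem lemma3p6:
  fixes S :: "real set" and n :: nat and \<alpha> :: real
    and \<Omega>\<^sub>k \<Omega>\<^sub>j :: "real list set" and x :: "real list"
  assumes "finite S" and "S \<noteq> {}" and "n \<ge> 1" and "0 < \<alpha>" and "\<alpha> < 1"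
    and "\<Omega>\<^sub>k \<subset> sample_space S n"
    and "x \<in> sample_space S n - \<Omega>\<^sub>k"
    and "\<Omega>\<^sub>j = \<Omega>\<^sub>k \<union> {x}"
    and "mean_minimizers S n \<alpha> \<Omega>\<^sub>k \<noteq> {}"
    and "\<exists>F \<in> mean_minimizers S n \<alpha> \<Omega>\<^sub>k. F \<in> open_prob_simplex S"
  shows "buehler_bound S n \<alpha> \<Omega>\<^sub>j < buehler_bound S n \<alpha> \<Omega>\<^sub>k \<and> buehler_bound S n \<alpha> \<Omega>\<^sub>k < \<infinity>"
proof -
  obtain F where F: "F \<in> mean_minimizers S n \<alpha> \<Omega>\<^sub>k" "F \<in> open_prob_simplex S"
    using assms(10) by blast
  have "F \<in> feasible_set S n \<alpha> \<Omega>\<^sub>k"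
    using F(1) by (auto simp: mean_minimizers_def is_arg_min_def)
  hence ge: "event_prob S n F \<Omega>\<^sub>k \<ge> \<alpha>"
    by (rule feasible_event_prob_ge)
  have "finite \<Omega>\<^sub>k"
    using assms(6) finite_sample_space[OF assms(1)] by (auto intro: finite_subset)
  hence "event_prob S n F \<Omega>\<^sub>j = event_prob S n F \<Omega>\<^sub>k + sample_prob S n F x"
    using assms(7,8) by (simp add: event_prob_def)
  with ge sample_prob_pos[OF F(2)] have gt: "event_prob S n F \<Omega>\<^sub>j > \<alpha>"
    by (smt (verit))
  have "\<Omega>\<^sub>k \<noteq> {}"
    using ge assms(4) by (auto simp: event_prob_def)
  then obtain y where y: "y \<in> sample_space S n" "y \<noteq> x"
    using assms(6,7) by blast
  have "\<not> S \<subseteq> {a}" for a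
  proof
    assume "S \<subseteq> {a}"
    with assms(2) have "S = {a}" by auto
    with y assms(7) sample_space_singleton[of a n] show False by auto
  qed
  then obtain a b where ab: "a \<in> S" "b \<in> S" "a < b"
    using assms(2) by (metis linorder_less_linear singletonI subsetI)
  obtain G where G: "G \<in> prob_simplex S" "event_prob S n G \<Omega>\<^sub>j > \<alpha>" "mean S G < mean S F"
    by (rule event_prob_slack_mean_less[OF assms(1) F(2) gt ab])
  have "buehler_bound S n \<alpha> \<Omega>\<^sub>j \<le> ereal (mean S G)"
    by (rule buehler_bound_le_mean[OF assms(1) feasible_setI[OF G(1,2)]])
  also have "\<dots> < ereal (mean S F)"
    using G(3) by simp
  finally show ?thesis
    by (simp add: buehler_bound_minimizer[OF F(1)])
qed

end
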